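(* Let $f$ be a piecewise linear-quadratic function on $\mathbb{R}^n$ and let $X\subseteq\mathbb{R}^n$ be a polyhedral set. Then the following two statements hold for the program of minimizing $f(x)$ over $x\in X$: (i) it has a finite number of isolated (strict, strong) local minima; (ii) it has a finite number of directional stationary values.
   Context: A continuous function $f:\mathbb{R}^n\to\mathbb{R}$ is piecewise linear-quadratic (PLQ) if there are finitely many quadratic functions $q_1,\dots,q_I$ (polynomials of degree at most 2) and polyhedra $P^1,\dots,P^I$ with union $\mathbb{R}^n$ such that $f=q_i$ on $P^i$ for each $i$. Such a function has one-sided directional derivatives $f'(x;v)=\lim_{\tau\downarrow 0}\frac{f(x+\tau v)-f(x)}{\tau}$ at every $x$ and in every direction $v$. A point $\bar x\in X$ is: a local minimizer of $f$ on $X$ if there is a neighborhood $\mathcal N$ of $\bar x$ with $f(x)\ge f(\bar x)$ for all $x\in X\cap\mathcal N$; a strict local minimizer if there is a neighborhood $\mathcal N$ of $\bar x$ with $f(x)>f(\bar x)$ for all $x\in X\cap\mathcal N$ with $x\neq\bar x$; an isolated local minimizer if there is a neighborhood $\mathcal N$ of $\bar x$ in which $\bar x$ is the only local minimizer of $f$ on $X$; a strong local minimizer if there are $c>0$ and a neighborhood $\mathcal N$ of $\bar x$ with $f(x)\ge f(\bar x)+c\|x-\bar x\|^2$ for all $x\in X\cap\mathcal N$. For PLQ programs over a polyhedral set the notions of isolated, strict and strong local minimizer are equivalent, so (i) applies to each of them. A point $\bar x\in X$ is a directional stationary point of the program if $f'(\bar x;x-\bar x)\ge 0$ for all $x\in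 X$; it need not be a local minimizer. A directional stationary value is a number $f(\bar x)$ where $\bar x$ is a directional stationary point. *)

theory Defs
  imports "HOL-Analysis.Analysis"
begin

definition quadratic_fun :: "(real^'n \<Rightarrow> real) \<Rightarrow> bool" where
  "quadratic_fun q \<longleftrightarrow> (\<exists>(A :: real^'n^'n) b c. \<forall>x. q x = x \<bullet> (A *v x) + b \<bullet> x + c)"

definition plq_fun :: "(real^'n \<Rightarrow> real) \<Rightarrow> bool" where
  "plq_fun f \<longleftrightarrow>
     continuous_on UNIV f \<and>
     (\<exists>(I::nat) q P.
        (\<forall>i<I. quadratic_fun (q i) \<and> polyhedron (P i)) \<and>
        (\<Union>i<I. P i) = UNIV \<and>
        (\<forall>i<I. \<forall>x\<in>P i. f x = q i x))"

definition dir_deriv :: "('a::real_normed_vector \<Rightarrow> real) \<Rightarrow> 'a \<Rightarrow> 'a \<Rightarrow> real" where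
  "dir_deriv f x v = Lim (at_right 0) (\<lambda>\<tau>. (f (x + \<tau> *\<^sub>R v) - f x) / \<tau>)"

definition local_minimizer :: "('a::real_normed_vector \<Rightarrow> real) \<Rightarrow> 'a set \<Rightarrow> 'a \<Rightarrow> bool" where
  "local_minimizer f X a \<longleftrightarrow>
     a \<in> X \<and> (\<exists>N. open N \<and> a \<in> N \<and> (\<forall>x\<in>X \<inter> N. f x \<ge> f a))"

definition strict_local_minimizer :: "('a::real_normed_vector \<Rightarrow> real) \<Rightarrow> 'a set \<Rightarrow> 'a \<Rightarrow> bool" where
  "strict_local_minimizer f X a \<longleftrightarrow>
     a \<in> X \<and> (\<exists>N. open N \<and> a \<in> N \<and> (\<forall>x\<in>X \<inter> N. x \<noteq> a \<longrightarrow> f x > f a))"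

definition isolated_local_minimizer :: "('a::real_normed_vector \<Rightarrow> real) \<Rightarrow> 'a set \<Rightarrow> 'a \<Rightarrow> bool" where
  "isolated_local_minimizer f X a \<longleftrightarrow>
     a \<in> X \<and> (\<exists>N. open N \<and> a \<in> N \<and> {x \<in> N. local_minimizer f X x} = {a})"

definition strong_local_minimizer :: "('a::real_normed_vector \<Rightarrow> real) \<Rightarrow> 'a set \<Rightarrow> 'a \<Rightarrow> bool" where
  "strong_local_minimizer f X a \<longleftrightarrow>
     a \<in> X \<and> (\<exists>c>0. \<exists>N. open N \<and> a \<in> N \<and> (\<forall>x\<in>X \<inter> N. f x \<ge> f a + c * (norm (x - a))\<^sup>2))"

definition dir_stationary :: "('a::real_normed_vector \<Rightarrow> real) \<Rightarrow> 'a set \<Rightarrow> 'a \<Rightarrow> bool" where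
  "dir_stationary f X a \<longleftrightarrow> a \<in> X \<and> (\<forall>x\<in>X. dir_deriv f a (x - a) \<ge> 0)"

text \<open>The limit defining \<open>dir_deriv\<close> exists for every PLQ function, so the
  description operator inside \<open>Lim\<close> never returns an unspecified value there.\<close>

lemma quadratic_fun_dir_deriv:
  fixes q :: "real^'n \<Rightarrow> real"
  assumes "quadratic_fun q"
  shows "\<exists>d. ((\<lambda>\<tau>. (q (x + \<tau> *\<^sub>R v) - q x) / \<tau>) \<longlongrightarrow> d) (at_right 0)"
proof -
  obtain A :: "real^'n^'n" and b c where q: "\<forall>x. q x = x \<bullet> (A *v x) + b \<bullet> x + c"
    using assms unfolding quadratic_fun_def by (elim exE)
  define d where "d = x \<bullet> (A *v v) + v \<bullet> (A *v x) + b \<bullet> v"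
  have eq: "(q (x + \<tau> *\<^sub>R v) - q x) / \<tau> = d + \<tau> * (v \<bullet> (A *v v))" if "\<tau> > 0" for \<tau>
  proof -
    have "q (x + \<tau> *\<^sub>R v) - q x = \<tau> * (d + \<tau> * (v \<bullet> (A *v v)))"
      by (simp add: q[rule_format] d_def matrix_vector_right_distrib matrix_vector_mult_scaleR
          algebra_simps)
    then show ?thesis using that by simp
  qed
  have "((\<lambda>\<tau>. d + \<tau> * (v \<bullet> (A *v v))) \<longlongrightarrow> d + 0 * (v \<bullet> (A *v v))) (at_right 0)"
    by (intro tendsto_intros)
  moreover have "\<forall>\<^sub>F \<tau> in at_right 0. d + \<tau> * (v \<bullet> (A *v v)) = (q (x + \<tau> *\<^sub>R v) - q x) / \<tau>"
    using eventually_at_right_less[of "0::real"] by eventually_elim (simp add: eq)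
  ultimately have "((\<lambda>\<tau>. (q (x + \<tau> *\<^sub>R v) - q x) / \<tau>) \<longlongrightarrow> d + 0 * (v \<bullet> (A *v v))) (at_right 0)"
    by (rule Lim_transform_eventually)
  then show ?thesis by blast
qed

lemma plq_fun_dir_deriv:
  fixes f :: "real^'n \<Rightarrow> real"
  assumes "plq_fun f"
  shows "((\<lambda>\<tau>. (f (x + \<tau> *\<^sub>R v) - f x) / \<tau>) \<longlongrightarrow> dir_deriv f x v) (at_right 0)"
proof -
  obtain I :: nat and q P where
    quad_poly: "\<forall>i<I. quadratic_fun (q i) \<and> polyhedron (P i)"
    and cover: "(\<Union>i<I. P i) = UNIV"
    and eq_pieces: "\<forall>i<I. \<forall>x\<in>P i. f x = q i x"
    using assms unfolding plq_fun_def by (elim exE conjE)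
  have qP: "quadratic_fun (q i)" "polyhedron (P i)" if "i < I" for i
    using quad_poly that by simp_all
  have eq: "f x = q i x" if "i < I" "x \<in> P i" for i x
    using eq_pieces that by simp
  have dich: "(\<forall>\<^sub>F \<tau> in at_right 0. x + \<tau> *\<^sub>R v \<in> P i) \<or> (\<forall>\<^sub>F \<tau> in at_right 0. x + \<tau> *\<^sub>R v \<notin> P i)"
    if i: "i < I" for i
  proof (rule disjCI)
    assume nev: "\<not> (\<forall>\<^sub>F \<tau> in at_right 0. x + \<tau> *\<^sub>R v \<notin> P i)"
    have ex: "\<exists>s. 0 < s \<and> s < t \<and> x + s *\<^sub>R v \<in> P i" if "0 < t" for t :: real
      using nev that unfolding eventually_at_right_field by blast
    obtain t where t: "0 < t" "x + t *\<^sub>R v \<in> P i"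
      using ex[OF zero_less_one] by blast
    have "x + s *\<^sub>R v \<in> P i" if s: "0 < s" "s < t" for s
    proof -
      obtain r where r: "0 < r" "r < s" "x + r *\<^sub>R v \<in> P i"
        using ex[OF s(1)] by blast
      define u where "u = (s - r) / (t - r)"
      have "0 < t - r" using r s by simp
      then have "0 \<le> u" "u \<le> 1"
        using r s by (simp_all add: u_def)
      moreover have "u * (t - r) = s - r"
        using \<open>0 < t - r\<close> by (simp add: u_def)
      then have "(1 - u) * r + u * t = s"
        by (simp add: algebra_simps)
      ultimately have u: "0 \<le> u" "u \<le> 1" "(1 - u) * r + u * t = s" by blast+
      have "(1 - u) *\<^sub>R (x + r *\<^sub>R v) + u *\<^sub>R (x + t *\<^sub>R v) \<in> P i"
        using polyhedron_imp_convex[OF qP(2)[OF i]] r(3) t(2) u(1,2)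
        by (simp add: convex_alt)
      also have "(1 - u) *\<^sub>R (x + r *\<^sub>R v) + u *\<^sub>R (x + t *\<^sub>R v) = x + ((1 - u) * r + u * t) *\<^sub>R v"
        by (simp add: algebra_simps)
      finally show ?thesis using u(3) by simp
    qed
    then show "\<forall>\<^sub>F \<tau> in at_right 0. x + \<tau> *\<^sub>R v \<in> P i"
      using t(1) unfolding eventually_at_right_field by blast
  qed
  have "\<exists>i<I. \<forall>\<^sub>F \<tau> in at_right 0. x + \<tau> *\<^sub>R v \<in> P i"
  proof (rule ccontr)
    assume "\<not> ?thesis"
    then have "\<forall>i\<in>{..<I}. \<forall>\<^sub>F \<tau> in at_right 0. x + \<tau> *\<^sub>R v \<notin> P i"
      using dich by auto
    then have "\<forall>\<^sub>F \<tau> in at_right 0. \<forall>i\<in>{..<I}. x + \<tau> *\<^sub>R v \<notin> P i"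
      by (intro eventually_ball_finite) auto
    then obtain \<tau> where "\<forall>i\<in>{..<I}. x + \<tau> *\<^sub>R v \<notin> P i"
      using eventually_happens by fastforce
    moreover have "x + \<tau> *\<^sub>R v \<in> (\<Union>i<I. P i)"
      by (simp only: cover UNIV_I)
    ultimately show False by blast
  qed
  then obtain i where i: "i < I" and ev: "\<forall>\<^sub>F \<tau> in at_right 0. x + \<tau> *\<^sub>R v \<in> P i"
    by blast
  have "((\<lambda>\<tau>. x + \<tau> *\<^sub>R v) \<longlongrightarrow> x + 0 *\<^sub>R v) (at_right 0)"
    by (intro tendsto_intros)
  then have "x \<in> P i"
    using Lim_in_closed_set[OF polyhedron_imp_closed[OF qP(2)[OF i]] ev] by simp
  obtain d where d: "((\<lambda>\<tau>. (q i (x + \<tau> *\<^sub>R v) - q i x) / \<tau>) \<longlongrightarrow> d) (at_right 0)"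
    using quadratic_fun_dir_deriv[OF qP(1)[OF i]] by blast
  have "\<forall>\<^sub>F \<tau> in at_right 0. (q i (x + \<tau> *\<^sub>R v) - q i x) / \<tau> = (f (x + \<tau> *\<^sub>R v) - f x) / \<tau>"
    using ev by eventually_elim (simp add: eq[OF i] \<open>x \<in> P i\<close>)
  with d have "((\<lambda>\<tau>. (f (x + \<tau> *\<^sub>R v) - f x) / \<tau>) \<longlongrightarrow> d) (at_right 0)"
    by (rule Lim_transform_eventually)
  moreover from this have "dir_deriv f x v = d"
    unfolding dir_deriv_def by (intro tendsto_Lim) auto
  ultimately show ?thesis by simp
qed

end

theory Submission
  imports Defs
begin

text \<open>Split \<open>X\<close> into finitely many classes, two points being in the same class if they lie in
  a common polyhedron on which \<open>f\<close> is quadratic and make the same defining inequalities of that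
  polyhedron tight. The line through two points of a class can be prolonged beyond both of them
  inside the polyhedron. If both points are directionally stationary, then the restriction of
  \<open>f\<close> to this line is a polynomial of degree at most 2 whose derivative vanishes at two points,
  so it is constant. Hence each class carries at most one stationary value and contains at most
  one strict local minimizer. Isolated and strong local minimizers are strict.\<close>

section \<open>Finite classes of points of a polyhedron with prolongable lines\<close>

text \<open>An interior point leaves room for a small step in any direction. Otherwise
  \<open>x\<close> and, by \<open>same\<close>, also \<open>y\<close> lie on the bounding
  hyperplane, which then contains the whole line through them.\<close>

lemma halfspace_prolongation:
  fixes a x y :: "'a::euclidean_space"
  assumes "a \<noteq> 0" and h: "h = {x. a \<bullet> x \<le> b}" and "x \<in> h" "y \<in> h"
    and same: "x \<in> interior h \<longleftrightarrow> y \<in> interior h"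
  shows "\<forall>\<^sub>F s in at_right 0. x + s *\<^sub>R (x - y) \<in> h"
proof (cases "x \<in> interior h")
  case True
  have "((\<lambda>s. x + s *\<^sub>R (x - y)) \<longlongrightarrow> x + 0 *\<^sub>R (x - y)) (at_right 0)"
    by (intro tendsto_intros)
  then have "\<forall>\<^sub>F s in at_right 0. x + s *\<^sub>R (x - y) \<in> interior h"
    by (rule topological_tendstoD) (use True in auto)
  then show ?thesis
    by eventually_elim (use interior_subset in blast)
next
  case False
  then have "a \<bullet> x = b" "a \<bullet> y = b"
    using assms by (auto simp: interior_halfspace_le)
  then show ?thesis
    by (simp add: h inner_add_right inner_diff_right)
qed

lemma polyhedron_prolongation_partition:
  fixes S :: "'a::euclidean_space set"
  assumes "polyhedron S"
  shows "\<exists>\<C>. finite \<C> \<and> \<Union>\<C> = S \<and>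
    (\<forall>C\<in>\<C>. \<forall>x\<in>C. \<forall>y\<in>C. \<forall>\<^sub>F s in at_right 0. x + s *\<^sub>R (x - y) \<in> S)"
proof -
  obtain F where F: "finite F" "S = \<Inter>F"
      "\<And>h. h \<in> F \<Longrightarrow> \<exists>a b. a \<noteq> 0 \<and> h = {x. a \<bullet> x \<le> b}"
    using assms unfolding polyhedron_def by auto
  \<comment> \<open>\<open>L\<close> collects the inequalities that are slack, so fixing
    \<open>L\<close> fixes the tight ones too. The nonempty cells are the relative interiors of
    faces of \<open>S\<close>.\<close>
  define cell where "cell L = {x \<in> S. {h \<in> F. x \<in> interior h} = L}" for L
  show ?thesis
  proof (intro exI conjI ballI)
    show "finite (cell ` Pow F)"
      using F(1) by simp
    show "\<Union>(cell ` Pow F) = S"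
    proof
      show "\<Union>(cell ` Pow F) \<subseteq> S"
        unfolding cell_def by blast
      show "S \<subseteq> \<Union>(cell ` Pow F)"
      proof
        fix x assume "x \<in> S"
        then have "x \<in> cell {h \<in> F. x \<in> interior h}"
          by (simp add: cell_def)
        moreover have "{h \<in> F. x \<in> interior h} \<in> Pow F"
          by simp
        ultimately show "x \<in> \<Union>(cell ` Pow F)"
          by (rule UN_I[rotated])
      qed
    qed
    fix C x y assume "C \<in> cell ` Pow F" and xy: "x \<in> C" "y \<in> C"
    then obtain L where C: "C = cell L" by blast
    have "\<forall>\<^sub>F s in at_right 0. \<forall>h\<in>F. x + s *\<^sub>R (x - y) \<in> h"
    proof (rule eventually_ball_finite[OF F(1)], rule ballI)
      fix h assume h: "h \<in> F"
      then obtain a b where "a \<noteq> 0" "h = {x. a \<bullet> x \<le> b}"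
        using F(3) by blast
      moreover have "x \<in> h" "y \<in> h"
        using xy h by (simp_all add: C cell_def F(2))
      moreover have "{h \<in> F. x \<in> interior h} = {h \<in> F. y \<in> interior h}"
        using xy by (simp add: C cell_def)
      then have "x \<in> interior h \<longleftrightarrow> y \<in> interior h"
        using h by blast
      ultimately show "\<forall>\<^sub>F s in at_right 0. x + s *\<^sub>R (x - y) \<in> h"
        by (rule halfspace_prolongation)
    qed
    then show "\<forall>\<^sub>F s in at_right 0. x + s *\<^sub>R (x - y) \<in> S"
      by (simp add: F(2))
  qed
qed

text \<open>Each polyhedron \<open>X \<inter> P i\<close> is split separately and serves as
  \<open>S\<close> for its own cells. Cells from different pieces may overlap, so
  \<open>\<C>\<close> is a finite cover of \<open>X\<close>, not necessarily a disjoint one.\<close>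

lemma plq_fun_quadratic_partition:
  fixes f :: "real^'n \<Rightarrow> real"
  assumes "plq_fun f" "polyhedron X"
  obtains \<C> where "finite \<C>" "\<Union>\<C> = X"
    "\<And>C. C \<in> \<C> \<Longrightarrow> \<exists>q S. quadratic_fun q \<and> convex S \<and> C \<subseteq> S \<and> S \<subseteq> X \<and> (\<forall>x\<in>S. f x = q x) \<and>
       (\<forall>x\<in>C. \<forall>y\<in>C. \<forall>\<^sub>F s in at_right 0. x + s *\<^sub>R (x - y) \<in> S)"
proof -
  obtain I :: nat and q P where
    pieces: "\<forall>i<I. quadratic_fun (q i) \<and> polyhedron (P i)"
    and cover: "(\<Union>i<I. P i) = UNIV"
    and eq_pieces: "\<forall>i<I. \<forall>x\<in>P i. f x = q i x"
    using assms(1) unfolding plq_fun_def by (elim exE conjE)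
  have q: "quadratic_fun (q i)" and P: "polyhedron (P i)" if "i < I" for i
    using pieces that by simp_all
  have eq: "f x = q i x" if "i < I" "x \<in> P i" for i x
    using eq_pieces that by simp
  have "\<exists>\<C>. finite \<C> \<and> \<Union>\<C> = X \<inter> P i \<and>
      (\<forall>C\<in>\<C>. \<forall>x\<in>C. \<forall>y\<in>C. \<forall>\<^sub>F s in at_right 0. x + s *\<^sub>R (x - y) \<in> X \<inter> P i)" if "i < I" for i
    using assms(2) P[OF that] by (intro polyhedron_prolongation_partition polyhedron_Int)
  then obtain \<D> where \<D>: "\<And>i. i < I \<Longrightarrow> finite (\<D> i) \<and> \<Union>(\<D> i) = X \<inter> P i \<and>
      (\<forall>C\<in>\<D> i. \<forall>x\<in>C. \<forall>y\<in>C. \<forall>\<^sub>F s in at_right 0. x + s *\<^sub>R (x - y) \<in> X \<inter> P i)"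
    by metis
  show thesis
  proof
    show "finite (\<Union>i<I. \<D> i)"
      using \<D> by blast
    have "\<Union>(\<Union>i<I. \<D> i) = (\<Union>i<I. \<Union>(\<D> i))"
      by blast
    also have "\<dots> = (\<Union>i<I. X \<inter> P i)"
      using \<D> by (intro SUP_cong) simp_all
    also have "\<dots> = X"
      by (simp only: Int_UN_distrib[symmetric] cover Int_UNIV_right)
    finally show "\<Union>(\<Union>i<I. \<D> i) = X" .
    fix C assume "C \<in> (\<Union>i<I. \<D> i)"
    then obtain i where i: "i < I" "C \<in> \<D> i" by blast
    have "convex (X \<inter> P i)"
      using assms(2) P[OF i(1)] by (simp add: polyhedron_imp_convex)
    moreover have "C \<subseteq> X \<inter> P i"
      using \<D>[OF i(1)] i(2) by blast
    ultimately show "\<exists>q S. quadratic_fun q \<and> convex S \<and> C \<subseteq> S \<and> S \<subseteq> X \<and> (\<forall>x\<in>S. f x = q x) \<and>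
       (\<forall>x\<in>C. \<forall>y\<in>C. \<forall>\<^sub>F s in at_right 0. x + s *\<^sub>R (x - y) \<in> S)"
      using q[OF i(1)] eq[OF i(1)] \<D>[OF i(1)] i(2)
      by (intro exI[of _ "q i"] exI[of _ "X \<inter> P i"]) simp
  qed
qed

section \<open>Directional stationarity along lines on which the function is quadratic\<close>

lemma quadratic_fun_on_line:
  fixes q :: "real^'n \<Rightarrow> real"
  assumes "quadratic_fun q"
  obtains \<alpha> \<beta> where "\<And>t. q (x + t *\<^sub>R v) = q x + \<alpha> * t + \<beta> * t\<^sup>2"
proof -
  obtain A :: "real^'n^'n" and b c where q: "\<forall>x. q x = x \<bullet> (A *v x) + b \<bullet> x + c"
    using assms unfolding quadratic_fun_def by (elim exE)
  have "q (x + t *\<^sub>R v) = q x + (x \<bullet> (A *v v) + v \<bullet> (A *v x) + b \<bullet> v) * t + v \<bullet> (A *v v) * t\<^sup>2" for t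
    by (simp add: q[rule_format] matrix_vector_right_distrib matrix_vector_mult_scaleR
        algebra_simps power2_eq_square)
  then show thesis by (rule that)
qed

text \<open>Dividing the increment by \<open>\<tau>\<close> leaves
  \<open>\<alpha> + \<beta> * \<tau>\<close>. The expansion is required only for small positive
  \<open>\<tau>\<close>, so the ray may leave the quadratic piece later.\<close>

lemma dir_deriv_eqI:
  fixes f :: "'a::real_normed_vector \<Rightarrow> real"
  assumes "\<forall>\<^sub>F \<tau> in at_right 0. f (x + \<tau> *\<^sub>R v) = f x + \<alpha> * \<tau> + \<beta> * \<tau>\<^sup>2"
  shows "dir_deriv f x v = \<alpha>"
proof -
  have "((\<lambda>\<tau>. \<alpha> + \<beta> * \<tau>) \<longlongrightarrow> \<alpha> + \<beta> * 0) (at_right 0)"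
    by (intro tendsto_intros)
  moreover have "\<forall>\<^sub>F \<tau> in at_right 0. \<alpha> + \<beta> * \<tau> = (f (x + \<tau> *\<^sub>R v) - f x) / \<tau>"
    using assms eventually_at_right_less[of "0::real"]
    by eventually_elim (simp add: field_simps power2_eq_square)
  ultimately have "((\<lambda>\<tau>. (f (x + \<tau> *\<^sub>R v) - f x) / \<tau>) \<longlongrightarrow> \<alpha> + \<beta> * 0) (at_right 0)"
    by (rule Lim_transform_eventually)
  then show ?thesis
    unfolding dir_deriv_def by (intro tendsto_Lim) auto
qed

lemma convex_segment_mem:
  assumes "convex S" "x \<in> S" "x + v \<in> S" "0 \<le> t" "t \<le> 1"
  shows "x + t *\<^sub>R v \<in> S"
  using convexD[OF assms(1-3), of "1 - t" t] assms(4,5) by (simp add: algebra_simps)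

text \<open>By convexity the segment from \<open>x\<close> to \<open>x + v\<close> stays in
  \<open>S\<close>, so \<open>\<alpha>\<close> is the directional derivative towards the feasible
  point \<open>x + v\<close>.\<close>

lemma dir_stationary_line_coeff_nonneg:
  assumes "dir_stationary f X x" "convex S" "S \<subseteq> X" "x \<in> S" "x + v \<in> S"
    and line: "\<And>t. x + t *\<^sub>R v \<in> S \<Longrightarrow> f (x + t *\<^sub>R v) = f x + \<alpha> * t + \<beta> * t\<^sup>2"
  shows "\<alpha> \<ge> 0"
proof -
  have "\<forall>\<^sub>F t in at_right (0::real). 0 < t \<and> t < 1"
    using eventually_at_right_real[of 0 1] by simp
  then have "\<forall>\<^sub>F t in at_right 0. f (x + t *\<^sub>R v) = f x + \<alpha> * t + \<beta> * t\<^sup>2"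
    by eventually_elim (use convex_segment_mem[OF assms(2,4,5)] in \<open>simp add: line\<close>)
  then have "dir_deriv f x v = \<alpha>"
    by (rule dir_deriv_eqI)
  moreover have "dir_deriv f x (x + v - x) \<ge> 0"
    using assms(1,3,5) unfolding dir_stationary_def by blast
  ultimately show ?thesis by simp
qed

text \<open>Prolonging the line beyond \<open>x\<close> makes a small multiple of \<open>- v\<close>
  an admissible direction as well, so the slope is bounded by 0 from both sides.\<close>

lemma dir_stationary_line_coeff_zero:
  assumes stat: "dir_stationary f X x" and S: "convex S" "S \<subseteq> X" "x \<in> S" "x + v \<in> S"
    and prolong: "\<forall>\<^sub>F s in at_right 0. x + s *\<^sub>R (- v) \<in> S"
    and line: "\<And>t. x + t *\<^sub>R v \<in> S \<Longrightarrow> f (x + t *\<^sub>R v) = f x + \<alpha> * t + \<beta> * t\<^sup>2"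
  shows "\<alpha> = 0"
proof -
  have "\<alpha> \<ge> 0"
    using stat S line by (rule dir_stationary_line_coeff_nonneg)
  have "\<forall>\<^sub>F s in at_right 0. 0 < s \<and> x + s *\<^sub>R (- v) \<in> S"
    using prolong eventually_at_right_less[of "0::real"] by eventually_elim simp
  then obtain s where s: "0 < s" "x + s *\<^sub>R (- v) \<in> S"
    by (blast dest: eventually_happens'[OF trivial_limit_at_right_real])
  \<comment> \<open>The direction is now \<open>s *\<^sub>R (- v)\<close>. Substituting
    \<open>- (t * s)\<close> for the parameter turns the coefficients into
    \<open>- (s * \<alpha>)\<close> and \<open>s\<^sup>2 * \<beta>\<close>.\<close>
  have "- (s * \<alpha>) \<ge> 0"
    using stat S(1-3) s(2)
  proof (rule dir_stationary_line_coeff_nonneg)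
    show "f (x + t *\<^sub>R s *\<^sub>R - v) = f x + - (s * \<alpha>) * t + (s\<^sup>2 * \<beta>) * t\<^sup>2"
      if "x + t *\<^sub>R s *\<^sub>R - v \<in> S" for t
      using line[of "- (t * s)"] that by (simp add: power_mult_distrib mult_ac)
  qed
  then show ?thesis
    using \<open>\<alpha> \<ge> 0\<close> s(1) by (simp add: mult_le_0_iff)
qed

text \<open>Stationarity at \<open>x\<close> kills the linear coefficient. Reading the same line
  from \<open>y\<close> then gives the slope \<open>- 2 * \<beta>\<close>, which stationarity at
  \<open>y\<close> kills too.\<close>

lemma quadratic_constant_between_stationary:
  fixes f q :: "real^'n \<Rightarrow> real"
  assumes q: "quadratic_fun q" and S: "convex S" "S \<subseteq> X"
    and eq: "\<And>z. z \<in> S \<Longrightarrow> f z = q z"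
    and x: "x \<in> S" "dir_stationary f X x" "\<forall>\<^sub>F s in at_right 0. x + s *\<^sub>R (x - y) \<in> S"
    and y: "y \<in> S" "dir_stationary f X y" "\<forall>\<^sub>F s in at_right 0. y + s *\<^sub>R (y - x) \<in> S"
    and t: "0 \<le> t" "t \<le> 1"
  shows "f (x + t *\<^sub>R (y - x)) = f x"
proof -
  obtain \<alpha> \<beta> where line: "\<And>t. q (x + t *\<^sub>R (y - x)) = q x + \<alpha> * t + \<beta> * t\<^sup>2"
    using quadratic_fun_on_line[OF q] by blast
  have "x + (y - x) \<in> S"
    using y(1) by simp
  moreover have "\<forall>\<^sub>F s in at_right 0. x + s *\<^sub>R (- (y - x)) \<in> S"
    using x(3) by simp
  ultimately have "\<alpha> = 0"
    by (rule dir_stationary_line_coeff_zero[OF x(2) S x(1), where \<beta> = \<beta>]) (simp add: eq x(1) line)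
  \<comment> \<open>The point \<open>y\<close> has parameter 1, so reversing the line replaces
    \<open>t\<close> by \<open>1 - t\<close> in \<open>\<beta> * t\<^sup>2\<close>.\<close>
  have rev: "q (y + t *\<^sub>R (x - y)) = q y + (- 2 * \<beta>) * t + \<beta> * t\<^sup>2" for t
  proof -
    have "y + t *\<^sub>R (x - y) = x + (1 - t) *\<^sub>R (y - x)"
      by (simp add: algebra_simps)
    then show ?thesis
      using line[of "1 - t"] line[of 1] \<open>\<alpha> = 0\<close> by (simp add: power2_eq_square algebra_simps)
  qed
  have "y + (x - y) \<in> S"
    using x(1) by simp
  moreover have "\<forall>\<^sub>F s in at_right 0. y + s *\<^sub>R (- (x - y)) \<in> S"
    using y(3) by simp
  ultimately have "- 2 * \<beta> = 0"
    by (rule dir_stationary_line_coeff_zero[OF y(2) S y(1), where \<beta> = \<beta>]) (simp add: eq y(1) rev)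
  have "x + t *\<^sub>R (y - x) \<in> S"
    using S(1) x(1) y(1) t by (intro convex_segment_mem) auto
  then show ?thesis
    using line[of t] \<open>\<alpha> = 0\<close> \<open>- 2 * \<beta> = 0\<close> by (simp add: eq x(1))
qed

section \<open>Local minimizers: stationarity and strictness\<close>

text \<open>Difference quotients towards feasible points are eventually nonnegative, and so is their
  limit. By \<open>plq_fun_dir_deriv\<close> this limit exists and equals
  \<open>dir_deriv\<close>.\<close>

lemma local_minimizer_imp_dir_stationary:
  fixes f :: "real^'n \<Rightarrow> real"
  assumes "plq_fun f" "convex X" and min: "local_minimizer f X a"
  shows "dir_stationary f X a"
  unfolding dir_stationary_def
proof (intro conjI ballI)
  show "a \<in> X"
    using min by (simp add: local_minimizer_def)
  fix x assume "x \<in> X"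
  obtain N where N: "open N" "a \<in> N" "\<And>z. z \<in> X \<inter> N \<Longrightarrow> f z \<ge> f a"
    using min by (auto simp: local_minimizer_def)
  have "((\<lambda>\<tau>. a + \<tau> *\<^sub>R (x - a)) \<longlongrightarrow> a + 0 *\<^sub>R (x - a)) (at_right 0)"
    by (intro tendsto_intros)
  then have "\<forall>\<^sub>F \<tau> in at_right 0. a + \<tau> *\<^sub>R (x - a) \<in> N"
    by (rule topological_tendstoD) (use N in auto)
  moreover have "\<forall>\<^sub>F \<tau> in at_right (0::real). 0 < \<tau> \<and> \<tau> < 1"
    using eventually_at_right_real[of 0 1] by simp
  ultimately have "\<forall>\<^sub>F \<tau> in at_right 0. 0 \<le> (f (a + \<tau> *\<^sub>R (x - a)) - f a) / \<tau>"
  proof eventually_elim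
    case (elim \<tau>)
    have "a + \<tau> *\<^sub>R (x - a) \<in> X"
      using assms(2) \<open>a \<in> X\<close> \<open>x \<in> X\<close> elim by (intro convex_segment_mem) auto
    then show ?case
      using N(3) elim by simp
  qed
  then show "0 \<le> dir_deriv f a (x - a)"
    by (intro tendsto_lowerbound[OF plq_fun_dir_deriv[OF assms(1)]]) auto
qed

lemma strict_local_minimizer_imp_local_minimizer:
  assumes "strict_local_minimizer f X a"
  shows "local_minimizer f X a"
  using assms unfolding strict_local_minimizer_def local_minimizer_def
  by (metis order_refl less_imp_le)

lemma strong_imp_strict_local_minimizer:
  assumes "strong_local_minimizer f X a"
  shows "strict_local_minimizer f X a"
proof -
  obtain c N where "c > 0" "open N" "a \<in> N"
    and N: "\<forall>x\<in>X \<inter> N. f x \<ge> f a + c * (norm (x - a))\<^sup>2"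
    using assms unfolding strong_local_minimizer_def by blast
  have "f x > f a" if "x \<in> X \<inter> N" "x \<noteq> a" for x
  proof -
    have "c * (norm (x - a))\<^sup>2 > 0"
      using \<open>c > 0\<close> that(2) by simp
    moreover have "f x \<ge> f a + c * (norm (x - a))\<^sup>2"
      using N that(1) by blast
    ultimately show ?thesis by linarith
  qed
  then show ?thesis
    using assms \<open>open N\<close> \<open>a \<in> N\<close>
    unfolding strict_local_minimizer_def strong_local_minimizer_def by blast
qed

lemma isolated_imp_strict_local_minimizer:
  assumes "isolated_local_minimizer f X a"
  shows "strict_local_minimizer f X a"
proof -
  obtain N where N: "open N" "a \<in> N" "{x \<in> N. local_minimizer f X x} = {a}"
    using assms unfolding isolated_local_minimizer_def by blast
  then have "local_minimizer f X a"
    by blast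
  then obtain M where M: "open M" "a \<in> M" "\<forall>x\<in>X \<inter> M. f x \<ge> f a" and "a \<in> X"
    unfolding local_minimizer_def by blast
  have "f x > f a" if x: "x \<in> X \<inter> (N \<inter> M)" "x \<noteq> a" for x
  proof (rule ccontr)
    assume "\<not> f x > f a"
    \<comment> \<open>\<open>x\<close> attains the minimum over the open set \<open>M\<close>, so it is a second local minimizer in \<open>N\<close>.\<close>
    then have "\<forall>y\<in>X \<inter> M. f y \<ge> f x"
      using M(3) by (meson not_less order_trans)
    then have "local_minimizer f X x"
      using x(1) M(1) unfolding local_minimizer_def by blast
    then show False
      using N(3) x by blast
  qed
  then show ?thesis
    using N(1,2) M(1,2) \<open>a \<in> X\<close> unfolding strict_local_minimizer_def
    by (intro conjI exI[of _ "N \<inter> M"]) auto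
qed

text \<open>The segment contains feasible points other than \<open>x\<close>, arbitrarily close to
  it, with the same value.\<close>

lemma not_strict_local_minimizer_segment:
  assumes "convex X" "x \<in> X" "y \<in> X" "x \<noteq> y"
    and const: "\<And>t. \<lbrakk>0 \<le> t; t \<le> 1\<rbrakk> \<Longrightarrow> f (x + t *\<^sub>R (y - x)) = f x"
  shows "\<not> strict_local_minimizer f X x"
proof
  assume "strict_local_minimizer f X x"
  then obtain N where N: "open N" "x \<in> N" "\<And>z. \<lbrakk>z \<in> X \<inter> N; z \<noteq> x\<rbrakk> \<Longrightarrow> f z > f x"
    unfolding strict_local_minimizer_def by blast
  have "((\<lambda>\<tau>. x + \<tau> *\<^sub>R (y - x)) \<longlongrightarrow> x + 0 *\<^sub>R (y - x)) (at_right 0)"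
    by (intro tendsto_intros)
  then have "\<forall>\<^sub>F \<tau> in at_right 0. x + \<tau> *\<^sub>R (y - x) \<in> N"
    by (rule topological_tendstoD) (use N in auto)
  moreover have "\<forall>\<^sub>F \<tau> in at_right (0::real). 0 < \<tau> \<and> \<tau> < 1"
    using eventually_at_right_real[of 0 1] by simp
  ultimately have "\<forall>\<^sub>F \<tau> in at_right (0::real). False"
  proof eventually_elim
    case (elim \<tau>)
    have "x + \<tau> *\<^sub>R (y - x) \<in> X"
      using assms(1-3) elim by (intro convex_segment_mem) auto
    then show ?case
      using N(3)[of "x + \<tau> *\<^sub>R (y - x)"] const[of \<tau>] elim \<open>x \<noteq> y\<close> by auto
  qed
  \<comment> \<open>The filter \<open>at_right 0\<close> is nontrivial, so \<open>False\<close>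
    cannot hold eventually.\<close>
  then show False by simp
qed

section \<open>Counting one value per class\<close>

text \<open>Each class contributes at most one value of \<open>g\<close>. Taking \<open>f\<close>
  for \<open>g\<close> counts stationary values, and taking \<open>id\<close> counts the strict
  minimizers themselves.\<close>

lemma finite_partition_subsingletons:
  assumes "finite \<C>" "D \<subseteq> \<Union>\<C>"
    and single: "\<And>C x y. \<lbrakk>C \<in> \<C>; x \<in> C \<inter> D; y \<in> C \<inter> D\<rbrakk> \<Longrightarrow> g x = g y"
  shows "finite (g ` D)"
proof (rule finite_subset)
  show "g ` D \<subseteq> (\<Union>C\<in>\<C>. g ` (C \<inter> D))"
    using assms(2) by blast
  have "finite (g ` (C \<inter> D))" if C: "C \<in> \<C>" for C
  proof (cases "C \<inter> D = {}")
    case False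
    then obtain x where "x \<in> C \<inter> D" by blast
    then have "g ` (C \<inter> D) \<subseteq> {g x}"
      using single[OF C] by blast
    then show ?thesis
      by (rule finite_subset) simp
  qed simp
  then show "finite (\<Union>C\<in>\<C>. g ` (C \<inter> D))"
    using assms(1) by blast
qed

theorem corollary1:
  fixes f :: "real^'n \<Rightarrow> real" and X :: "(real^'n) set"
  assumes "plq_fun f" and "polyhedron X"
  shows "(finite {x. isolated_local_minimizer f X x} \<and>
          finite {x. strict_local_minimizer f X x} \<and>
          finite {x. strong_local_minimizer f X x}) \<and>
         finite {f x | x. dir_stationary f X x}"
proof -
  have "convex X"
    using assms(2) by (rule polyhedron_imp_convex)
  obtain \<C> where fin: "finite \<C>" and cover: "\<Union>\<C> = X"
    and cell: "\<And>C. C \<in> \<C> \<Longrightarrow> \<exists>q S. quadratic_fun q \<and> convex S \<and> C \<subseteq> S \<and> S \<subseteq> X \<and>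
       (\<forall>x\<in>S. f x = q x) \<and> (\<forall>x\<in>C. \<forall>y\<in>C. \<forall>\<^sub>F s in at_right 0. x + s *\<^sub>R (x - y) \<in> S)"
    using plq_fun_quadratic_partition[OF assms] by blast
  \<comment> \<open>Both finiteness claims rest on this: the endpoint \<open>t = 1\<close> equates
    the two stationary values, while small positive \<open>t\<close> refutes strictness at
    \<open>x\<close>.\<close>
  have const: "f (x + t *\<^sub>R (y - x)) = f x"
    if C: "C \<in> \<C>" and xy: "x \<in> C" "y \<in> C" and stat: "dir_stationary f X x" "dir_stationary f X y"
      and t: "0 \<le> t" "t \<le> 1" for C x y t
  proof -
    obtain q S where q: "quadratic_fun q" and S: "convex S" "S \<subseteq> X" and "C \<subseteq> S"
      and eq: "\<And>z. z \<in> S \<Longrightarrow> f z = q z"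
      and prolong: "\<forall>x\<in>C. \<forall>y\<in>C. \<forall>\<^sub>F s in at_right 0. x + s *\<^sub>R (x - y) \<in> S"
      using cell[OF C] by blast
    show ?thesis
      using xy \<open>C \<subseteq> S\<close> prolong
      by (intro quadratic_constant_between_stationary[OF q S eq _ stat(1) _ _ stat(2) _ t]) auto
  qed
  have "finite (f ` {x. dir_stationary f X x})"
  proof (rule finite_partition_subsingletons[OF fin])
    show "{x. dir_stationary f X x} \<subseteq> \<Union>\<C>"
      by (auto simp: cover dir_stationary_def)
    show "f x = f y"
      if "C \<in> \<C>" "x \<in> C \<inter> {x. dir_stationary f X x}" "y \<in> C \<inter> {x. dir_stationary f X x}" for C x y
      using const[of C x y 1] that by simp
  qed
  then have finite_values: "finite {f x | x. dir_stationary f X x}"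
    by (simp add: image_Collect)
  have "finite (id ` {x. strict_local_minimizer f X x})"
  proof (rule finite_partition_subsingletons[OF fin])
    show "{x. strict_local_minimizer f X x} \<subseteq> \<Union>\<C>"
      by (auto simp: cover strict_local_minimizer_def)
    fix C x y
    assume C: "C \<in> \<C>" and "x \<in> C \<inter> {x. strict_local_minimizer f X x}"
      "y \<in> C \<inter> {x. strict_local_minimizer f X x}"
    then have x: "x \<in> C" "strict_local_minimizer f X x" and y: "y \<in> C" "strict_local_minimizer f X y"
      by auto
    then have "dir_stationary f X x" "dir_stationary f X y"
      using local_minimizer_imp_dir_stationary[OF assms(1) \<open>convex X\<close>]
        strict_local_minimizer_imp_local_minimizer by blast+
    moreover have "x \<in> X" "y \<in> X"
      using C x(1) y(1) cover by blast+
    \<comment> \<open>If \<open>x\<close> and \<open>y\<close> differed, \<open>f\<close> would be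
      constant on the segment joining them, contradicting strictness at \<open>x\<close>.\<close>
    ultimately show "id x = id y"
      using not_strict_local_minimizer_segment[OF \<open>convex X\<close>] const[OF C x(1) y(1)] x(2)
      by fastforce
  qed
  then have "finite {x. strict_local_minimizer f X x}"
    by simp
  moreover from this have "finite {x. isolated_local_minimizer f X x}"
    by (rule rev_finite_subset) (use isolated_imp_strict_local_minimizer in blast)
  moreover have "finite {x. strong_local_minimizer f X x}"
    using \<open>finite {x. strict_local_minimizer f X x}\<close>
    by (rule rev_finite_subset) (use strong_imp_strict_local_minimizer in blast)
  ultimately show ?thesis
    using finite_values by blast
qed

end
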